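(* Let $n\ge1$ and let $A\subset\mathbb Z^n$ be a finite nonempty set. Suppose that $A$ coincides with the set of vertices of the convex hull of $A$ in $\mathbb R^n$, and that the intersection of the convex hull of $A$ with $\mathbb Z^n$ consists only of $A$. Let $c_p$, $p\in A$, be arbitrary integers and define $\Psi:\mathbb Z^n\to\mathbb Z$ by $\Psi(z)=\min_{p\in A}(p\cdot z+c_p)$. Then the sequence $(\Psi)_k$ of huskings of $\Psi$ eventually stabilises, i.e. there exists $N$ such that for all $k>N$ we have $(\Psi)_k=(\Psi)_N$.
   Context: For $z,z'\in\mathbb Z^n$, $z\sim z'$ means that their Euclidean distance is $1$. The discrete Laplacian is $\Delta F(z)=-2nF(z)+\sum_{z'\sim z}F(z')$; $F$ is superharmonic if $\Delta F\le0$ everywhere (a minimum of finitely many affine functions is superharmonic). $D(F)=\{z:\Delta F(z)\ne0\}$. $B_C(S)$ is the set of points of $\mathbb Z^n$ at Euclidean distance at most $C$ from $S$ (empty if $S$ is empty). For a superharmonic $F:\mathbb Z^n\to\mathbb Z$ and $k\in\mathbb Z_{\ge0}$, $$\Theta_k(F)=\{G:\mathbb Z^n\to\mathbb Z\mid\Delta G\le0,\ F-k\le G\le F,\ \exists C>0:\{F\ne G\}\subset B_C(D(F))\},$$ and the $k$-husking of $F$ is $(F)_k(z)=\min\{G(z):G\in\Theta_k(F)\}$. *)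

theory Defs
  imports "HOL-Analysis.Analysis"
begin

definition real_vec :: "int ^ 'n \<Rightarrow> real ^ 'n" where
  "real_vec z = (\<chi> i. real_of_int (z $ i))"

definition lattice_adj :: "int ^ 'n \<Rightarrow> int ^ 'n \<Rightarrow> bool" where
  "lattice_adj z z' \<longleftrightarrow> dist (real_vec z) (real_vec z') = 1"

definition laplacian :: "(int ^ 'n \<Rightarrow> int) \<Rightarrow> int ^ 'n \<Rightarrow> int" where
  "laplacian F z = - 2 * int CARD('n) * F z + (\<Sum>z' | lattice_adj z z'. F z')"

definition superharmonic :: "(int ^ 'n \<Rightarrow> int) \<Rightarrow> bool" where
  "superharmonic F \<longleftrightarrow> (\<forall>z. laplacian F z \<le> 0)"

definition deviation_set :: "(int ^ 'n \<Rightarrow> int) \<Rightarrow> (int ^ 'n) set" where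
  "deviation_set F = {z. laplacian F z \<noteq> 0}"

text \<open>The Euclidean distance from a lattice point to a nonempty set of lattice points is
  attained, so the distance to \<open>S\<close> is at most \<open>C\<close> iff the distance to some point of \<open>S\<close> is.\<close>

definition lattice_nbhd :: "real \<Rightarrow> (int ^ 'n) set \<Rightarrow> (int ^ 'n) set" where
  "lattice_nbhd C S = {z. \<exists>s\<in>S. dist (real_vec z) (real_vec s) \<le> C}"

definition husking_set :: "nat \<Rightarrow> (int ^ 'n \<Rightarrow> int) \<Rightarrow> (int ^ 'n \<Rightarrow> int) set" where
  "husking_set k F =
     {G. superharmonic G \<and> (\<forall>z. F z - int k \<le> G z \<and> G z \<le> F z) \<and>
         (\<exists>C>0. {z. F z \<noteq> G z} \<subseteq> lattice_nbhd C (deviation_set F))}"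

text \<open>For superharmonic \<open>F\<close> the minimum is taken over a finite nonempty set of integers; see
  the lemmas below.\<close>

definition husking :: "nat \<Rightarrow> (int ^ 'n \<Rightarrow> int) \<Rightarrow> int ^ 'n \<Rightarrow> int" where
  "husking k F z = Min {G z | G. G \<in> husking_set k F}"

definition int_inner :: "int ^ 'n \<Rightarrow> int ^ 'n \<Rightarrow> int" where
  "int_inner p z = (\<Sum>i\<in>UNIV. p $ i * z $ i)"

text \<open>The sum in the Laplacian ranges over a finite set.\<close>

lemma finite_lattice_adj: "finite {z'. lattice_adj (z :: int ^ 'n) z'}"
proof -
  let ?T = "PiE (UNIV :: 'n set) (\<lambda>i. {z $ i - 1 .. z $ i + 1})"
  have "{z'. lattice_adj z z'} \<subseteq> vec_lambda ` ?T"
  proof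
    fix z' assume "z' \<in> {z'. lattice_adj z z'}"
    then have d: "dist (real_vec z) (real_vec z') = 1"
      by (simp add: lattice_adj_def)
    have "z' $ i \<in> {z $ i - 1 .. z $ i + 1}" for i
    proof -
      have "dist (real_vec z $ i) (real_vec z' $ i) \<le> 1"
        using dist_vec_nth_le[of "real_vec z" i "real_vec z'"] d by simp
      then have "\<bar>real_of_int (z $ i - z' $ i)\<bar> \<le> 1"
        by (simp add: real_vec_def dist_real_def)
      then have "\<bar>z $ i - z' $ i\<bar> \<le> 1" by linarith
      then show ?thesis by auto
    qed
    then have "vec_nth z' \<in> ?T" by auto
    then show "z' \<in> vec_lambda ` ?T" by (metis image_eqI vec_nth_inverse)
  qed
  moreover have "finite ?T" by (intro finite_PiE) auto
  ultimately show ?thesis by (meson finite_imageI finite_subset)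
qed

lemma finite_husking_values: "finite {G z | G. G \<in> husking_set k F}"
  by (rule finite_subset[of _ "{F z - int k .. F z}"]) (auto simp: husking_set_def)

lemma husking_values_nonempty:
  assumes "superharmonic F"
  shows "{G z | G. G \<in> husking_set k F} \<noteq> {}"
proof -
  have "F \<in> husking_set k F"
    using assms by (auto simp: husking_set_def intro: exI[of _ "1::real"])
  then show ?thesis by blast
qed

end

theory Submission imports Defs begin

text \<open>It suffices to bound \<open>\<Psi> - G\<close> uniformly over all \<open>k\<close> and all \<open>G\<close> in the husking set, since
  then these sets do not depend on \<open>k\<close> for large \<open>k\<close>. Let \<open>h v = max {p \<cdot> v | p \<in> A}\<close> and replace \<open>G\<close>
  by its inf-convolution \<open>H z = min {G y + h (z - y) | y}\<close>, which is superharmonic, lies below \<open>G\<close>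
  and satisfies \<open>H (z + v) \<le> H z + h v\<close>. As \<open>H\<close> is Lipschitz, within bounded distance of every
  point there is a large box on which \<open>H\<close> is harmonic; the differences of \<open>H\<close> are bounded
  integer-valued harmonic functions there, hence constant on a smaller box by the maximum principle,
  and \<open>H\<close> is affine on it, with slope \<open>p\<close>. Then \<open>p\<close> lies in the convex hull of \<open>A\<close>, so \<open>p \<in> A\<close>.
  Since \<open>p\<close> is a vertex, some integer direction \<open>w\<close> satisfies \<open>p \<cdot> w < q \<cdot> w\<close> for all other
  \<open>q \<in> A\<close>. The maximum principle propagates \<open>H x = p \<cdot> x + b\<close> along \<open>w\<close>, and comparison with
  \<open>\<Psi>\<close> far away gives \<open>b \<ge> c p\<close>. So \<open>H \<ge> \<Psi>\<close> somewhere within bounded distance of every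
  point, and the Lipschitz bounds finish the proof.\<close>

section \<open>The lattice Laplacian and boxes\<close>

lemma int_inner_add: "int_inner p (x + y) = int_inner p x + int_inner p y"
  by (simp add: int_inner_def distrib_left sum.distrib)

lemma int_inner_diff: "int_inner p (x - y) = int_inner p x - int_inner p y"
  by (simp add: int_inner_def right_diff_distrib sum_subtractf)

lemma int_inner_minus: "int_inner p (- y) = - int_inner p y"
  by (simp add: int_inner_def sum_negf)

lemma int_inner_zero: "int_inner p 0 = 0"
  by (simp add: int_inner_def)

lemma int_inner_scale: "int_inner p (t *s w) = t * int_inner p w"
  by (simp add: int_inner_def sum_distrib_left algebra_simps)

lemma int_inner_axis: "int_inner p (axis i 1) = p $ i"
proof -
  have "int_inner p (axis i 1) = (\<Sum>j\<in>UNIV. if j = i then p $ i else 0)"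
    unfolding int_inner_def by (intro sum.cong) (auto simp: axis_def)
  then show ?thesis by simp
qed

lemmas int_inner_simps = int_inner_add int_inner_diff int_inner_minus int_inner_zero
  int_inner_scale int_inner_axis

lemma abs_int_inner_le:
  fixes p w :: "int ^ 'n"
  assumes "\<And>i. \<bar>p $ i\<bar> \<le> K"
  shows "\<bar>int_inner p w\<bar> \<le> K * (\<Sum>i\<in>UNIV. \<bar>w $ i\<bar>)"
proof -
  have "\<bar>int_inner p w\<bar> \<le> (\<Sum>i\<in>UNIV. \<bar>p $ i * w $ i\<bar>)"
    unfolding int_inner_def by (rule sum_abs)
  also have "\<dots> \<le> (\<Sum>i\<in>UNIV. K * \<bar>w $ i\<bar>)"
    unfolding abs_mult using assms by (intro sum_mono mult_right_mono) auto
  finally show ?thesis by (simp add: sum_distrib_left)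
qed

lemma lattice_adj_iff_sum:
  "lattice_adj z z' \<longleftrightarrow> (\<Sum>i\<in>UNIV. (z $ i - z' $ i)\<^sup>2) = 1"
proof -
  have "dist (real_vec z) (real_vec z') = sqrt (real_of_int (\<Sum>i\<in>UNIV. (z $ i - z' $ i)\<^sup>2))"
    by (simp add: dist_vec_def L2_set_def real_vec_def dist_real_def)
  then show ?thesis
    unfolding lattice_adj_def by (metis of_int_eq_1_iff real_sqrt_eq_1_iff)
qed

text \<open>Integer squares with sum 1 are all zero except for a single 1.\<close>

lemma lattice_adj_iff:
  "lattice_adj z z' \<longleftrightarrow> (\<exists>i. z' = z + axis i 1 \<or> z' = z - axis i 1)"
proof
  assume "lattice_adj z z'"
  then have s: "(\<Sum>i\<in>UNIV. (z $ i - z' $ i)\<^sup>2) = 1"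
    by (simp add: lattice_adj_iff_sum)
  then obtain i where i: "z $ i \<noteq> z' $ i"
    by fastforce
  have split: "(\<Sum>j\<in>UNIV. (z $ j - z' $ j)\<^sup>2)
      = (z $ i - z' $ i)\<^sup>2 + (\<Sum>j\<in>UNIV - {i}. (z $ j - z' $ j)\<^sup>2)"
    by (rule sum.remove) auto
  have "(z $ i - z' $ i)\<^sup>2 > 0" using i by simp
  moreover have "(\<Sum>j\<in>UNIV - {i}. (z $ j - z' $ j)\<^sup>2) \<ge> 0"
    by (rule sum_nonneg) simp
  ultimately have one: "(z $ i - z' $ i)\<^sup>2 = 1"
    and rest: "(\<Sum>j\<in>UNIV - {i}. (z $ j - z' $ j)\<^sup>2) = 0"
    using s split by linarith+
  have "z' $ j = z $ j" if "j \<noteq> i" for j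
    using rest that by (simp add: sum_nonneg_eq_0_iff)
  moreover have "z' $ i = z $ i + 1 \<or> z' $ i = z $ i - 1"
    using one by (auto simp: power2_eq_1_iff)
  ultimately have "z' = z + axis i 1 \<or> z' = z - axis i 1"
    by (auto simp: vec_eq_iff axis_def)
  then show "\<exists>i. z' = z + axis i 1 \<or> z' = z - axis i 1" ..
next
  assume "\<exists>i. z' = z + axis i 1 \<or> z' = z - axis i 1"
  then obtain i where i: "z' = z + axis i 1 \<or> z' = z - axis i 1" ..
  then have "(z $ j - z' $ j)\<^sup>2 = (if j = i then 1 else 0)" for j
    by (auto simp: axis_def)
  then show "lattice_adj z z'" by (simp add: lattice_adj_iff_sum)
qed

text \<open>Grouping the neighbours into second differences along the axes lets linearity and
  comparison be checked axis by axis.\<close>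

lemma laplacian_eq:
  fixes F :: "int ^ 'n \<Rightarrow> int"
  shows "laplacian F z = (\<Sum>i\<in>UNIV. F (z + axis i 1) + F (z - axis i 1) - 2 * F z)"
proof -
  let ?P = "range (\<lambda>i. z + axis i 1)" and ?M = "range (\<lambda>i. z - axis i 1)"
  have inj: "inj (\<lambda>i::'n. z + axis i 1)" "inj (\<lambda>i::'n. z - axis i 1)"
    by (auto simp: inj_def axis_eq_axis)
  have disj: "?P \<inter> ?M = {}"
  proof -
    have "z + axis i 1 \<noteq> z - axis j 1" for i j :: 'n
    proof
      assume "z + axis i 1 = z - axis j 1"
      then have "(z + axis i 1) $ i = (z - axis j 1) $ i" by simp
      then show False by (auto simp: axis_def split: if_splits)
    qed
    then show ?thesis by blast
  qed
  have "{z'. lattice_adj z z'} = ?P \<union> ?M"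
    by (auto simp: lattice_adj_iff)
  then have "(\<Sum>z' | lattice_adj z z'. F z') = sum F ?P + sum F ?M"
    using disj by (simp add: sum.union_disjoint)
  also have "\<dots> = (\<Sum>i\<in>UNIV. F (z + axis i 1)) + (\<Sum>i\<in>UNIV. F (z - axis i 1))"
    using inj by (simp add: sum.reindex)
  finally show ?thesis
    by (simp add: laplacian_def sum.distrib sum_subtractf)
qed

lemma laplacian_add: "laplacian (\<lambda>x. F x + G x) z = laplacian F z + laplacian G z"
  unfolding laplacian_eq sum.distrib[symmetric] by (rule sum.cong) (simp_all add: algebra_simps)

lemma laplacian_diff: "laplacian (\<lambda>x. F x - G x) z = laplacian F z - laplacian G z"
  unfolding laplacian_eq sum_subtractf[symmetric] by (rule sum.cong) (simp_all add: algebra_simps)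

lemma laplacian_cmult: "laplacian (\<lambda>x. a * F x) z = a * laplacian F z"
  unfolding laplacian_eq sum_distrib_left by (rule sum.cong) (simp_all add: algebra_simps)

lemma laplacian_sum: "laplacian (\<lambda>x. \<Sum>y\<in>S. F y x) z = (\<Sum>y\<in>S. laplacian (F y) z)"
proof (induction S rule: infinite_finite_induct)
  case (insert y S)
  then show ?case by (simp add: laplacian_add)
qed (auto simp: laplacian_eq)

lemma laplacian_shift: "laplacian (\<lambda>x. F (x + v)) z = laplacian F (z + v)"
  by (simp add: laplacian_eq algebra_simps)

lemma laplacian_affine: "laplacian (\<lambda>x. int_inner p x + a) z = 0"
  by (simp add: laplacian_eq int_inner_simps)

text \<open>This positive constant makes the squared distance the strictly subharmonic perturbation
  used in \<open>harmonic_translate_nearby\<close>.\<close>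

lemma laplacian_sq_dist:
  fixes z c :: "int ^ 'n"
  shows "laplacian (\<lambda>x. \<Sum>j\<in>UNIV. (x $ j - c $ j)\<^sup>2) z = 2 * int CARD('n)"
proof -
  have "(\<Sum>j\<in>UNIV. ((z + axis i 1) $ j - c $ j)\<^sup>2) + (\<Sum>j\<in>UNIV. ((z - axis i 1) $ j - c $ j)\<^sup>2)
     - 2 * (\<Sum>j\<in>UNIV. (z $ j - c $ j)\<^sup>2) = 2" (is "?L = 2") for i
  proof -
    have "?L = (\<Sum>j\<in>UNIV. ((z + axis i 1) $ j - c $ j)\<^sup>2 + ((z - axis i 1) $ j - c $ j)\<^sup>2
       - 2 * (z $ j - c $ j)\<^sup>2)"
      by (simp add: sum.distrib sum_subtractf sum_distrib_left)
    also have "\<dots> = (\<Sum>j\<in>UNIV. if j = i then 2 else 0)"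
      by (intro sum.cong) (auto simp: axis_def power2_eq_square algebra_simps)
    finally show ?thesis by simp
  qed
  then show ?thesis by (simp add: laplacian_eq)
qed

text \<open>Balls of the sup norm, whose integer radius grows by one per lattice step.\<close>

definition lattice_box :: "int ^ 'n \<Rightarrow> int \<Rightarrow> (int ^ 'n) set" where
  "lattice_box c r = {x. \<forall>i. \<bar>x $ i - c $ i\<bar> \<le> r}"

lemma finite_lattice_box: "finite (lattice_box (c :: int ^ 'n) r)"
proof -
  let ?T = "PiE (UNIV :: 'n set) (\<lambda>i. {c $ i - r .. c $ i + r})"
  have "vec_nth x \<in> ?T" if "x \<in> lattice_box c r" for x
  proof -
    have "x $ i \<in> {c $ i - r .. c $ i + r}" for i
    proof -
      have "\<bar>x $ i - c $ i\<bar> \<le> r" using that by (simp add: lattice_box_def)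
      then show ?thesis by auto
    qed
    then show ?thesis by auto
  qed
  then have "lattice_box c r \<subseteq> vec_lambda ` ?T"
    by (intro subsetI) (rule image_eqI, rule vec_nth_inverse[symmetric])
  moreover have "finite ?T" by (intro finite_PiE) auto
  ultimately show ?thesis by (meson finite_imageI finite_subset)
qed

lemma lattice_box_center: "0 \<le> r \<Longrightarrow> c \<in> lattice_box c r"
  by (simp add: lattice_box_def)

lemma lattice_box_mono: "r \<le> s \<Longrightarrow> lattice_box c r \<subseteq> lattice_box c s"
  by (auto simp: lattice_box_def intro: order_trans)

lemma lattice_box_sum_le:
  fixes x :: "int ^ 'n"
  assumes "x \<in> lattice_box c r"
  shows "(\<Sum>i\<in>UNIV. \<bar>(x - c) $ i\<bar>) \<le> int CARD('n) * r"
proof -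
  have "(\<Sum>i\<in>UNIV. \<bar>(x - c) $ i\<bar>) \<le> (\<Sum>i\<in>(UNIV :: 'n set). r)"
    using assms by (intro sum_mono) (simp add: lattice_box_def)
  then show ?thesis by simp
qed

lemma lattice_box_commute: "x \<in> lattice_box c r \<longleftrightarrow> c \<in> lattice_box x r"
  by (simp add: lattice_box_def abs_minus_commute)

lemma dist_imp_lattice_box:
  assumes "dist (real_vec x) (real_vec c) \<le> C"
  shows "x \<in> lattice_box c \<lceil>C\<rceil>"
proof -
  have "\<bar>x $ i - c $ i\<bar> \<le> \<lceil>C\<rceil>" for i
  proof -
    have "dist (real_vec x $ i) (real_vec c $ i) \<le> C"
      using dist_vec_nth_le assms by (rule order_trans)
    then have "real_of_int \<bar>x $ i - c $ i\<bar> \<le> C"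
      by (simp add: real_vec_def dist_real_def)
    then show ?thesis by linarith
  qed
  then show ?thesis by (simp add: lattice_box_def)
qed

lemma finite_subset_lattice_box:
  fixes B :: "(int ^ 'n) set"
  assumes "finite B"
  shows "\<exists>r\<ge>0. B \<subseteq> lattice_box 0 r"
proof (intro exI conjI subsetI)
  let ?r = "\<Sum>p\<in>B. \<Sum>i\<in>UNIV. \<bar>p $ i\<bar>"
  show "0 \<le> ?r" by (intro sum_nonneg abs_ge_zero)
  fix p assume "p \<in> B"
  have "\<bar>p $ i\<bar> \<le> ?r" for i
  proof -
    have "\<bar>p $ i\<bar> \<le> (\<Sum>i\<in>UNIV. \<bar>p $ i\<bar>)"
      by (rule member_le_sum) auto
    also have "\<dots> \<le> ?r"
      using assms \<open>p \<in> B\<close> by (intro member_le_sum) (auto intro: sum_nonneg)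
    finally show ?thesis .
  qed
  then show "p \<in> lattice_box 0 ?r" by (simp add: lattice_box_def)
qed

lemma lattice_box_step:
  assumes "x \<in> lattice_box c r"
  shows "x + axis i 1 \<in> lattice_box c (r + 1)" "x - axis i 1 \<in> lattice_box c (r + 1)"
proof -
  have "\<bar>x $ j - c $ j\<bar> \<le> r" for j
    using assms by (simp add: lattice_box_def)
  then show "x + axis i 1 \<in> lattice_box c (r + 1)" "x - axis i 1 \<in> lattice_box c (r + 1)"
    by (simp_all add: lattice_box_def axis_def) (smt (verit))+
qed

text \<open>Boxes are connected by lattice steps: moving one coordinate toward \<open>y\<close>
  stays in the box and lowers the l1 distance to \<open>y\<close>, the induction measure.\<close>

lemma lattice_box_induct:
  assumes y: "y \<in> lattice_box c r" and "x \<in> lattice_box c r" and "P x"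
    and step: "\<And>x i. x \<in> lattice_box c r \<Longrightarrow> P x \<Longrightarrow> P (x + axis i 1) \<and> P (x - axis i 1)"
  shows "P y"
  using assms(2,3)
proof (induction "\<Sum>i\<in>UNIV. nat \<bar>y $ i - x $ i\<bar>" arbitrary: x rule: less_induct)
  case less
  show ?case
  proof (cases "x = y")
    case False
    then obtain i where i: "x $ i \<noteq> y $ i" by (auto simp: vec_eq_iff)
    define x' where "x' = (if x $ i < y $ i then x + axis i 1 else x - axis i 1)"
    have P': "P x'" using step[OF less.prems, of i] by (simp add: x'_def)
    have yb: "\<bar>y $ j - c $ j\<bar> \<le> r" and xb: "\<bar>x $ j - c $ j\<bar> \<le> r" for j
      using y less.prems(1) by (auto simp: lattice_box_def)
    have ne: "x' $ j = x $ j" if "j \<noteq> i" for j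
      using that by (simp add: x'_def axis_def)
    have eq: "x' $ i = (if x $ i < y $ i then x $ i + 1 else x $ i - 1)"
      by (simp add: x'_def axis_def)
    have "\<bar>x' $ j - c $ j\<bar> \<le> r" for j
      using yb[of i] xb[of i] xb[of j] eq ne[of j] i by (cases "j = i") (auto split: if_splits)
    then have x'_box: "x' \<in> lattice_box c r" by (simp add: lattice_box_def)
    have "(\<Sum>j\<in>UNIV. nat \<bar>y $ j - x' $ j\<bar>) < (\<Sum>j\<in>UNIV. nat \<bar>y $ j - x $ j\<bar>)"
    proof (rule sum_strict_mono_ex1)
      show "\<forall>j\<in>UNIV. nat \<bar>y $ j - x' $ j\<bar> \<le> nat \<bar>y $ j - x $ j\<bar>"
      proof
        fix j
        show "nat \<bar>y $ j - x' $ j\<bar> \<le> nat \<bar>y $ j - x $ j\<bar>"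
          using eq ne[of j] i by (cases "j = i") auto
      qed
      show "\<exists>j\<in>UNIV. nat \<bar>y $ j - x' $ j\<bar> < nat \<bar>y $ j - x $ j\<bar>"
        using eq i by (intro bexI[of _ i]) auto
    qed simp
    then show ?thesis using less.hyps x'_box P' by blast
  qed (use less.prems in simp)
qed

section \<open>Maximum principle and discrete harmonic functions on boxes\<close>

lemma max_principle_neighbours:
  fixes f :: "int ^ 'n \<Rightarrow> int"
  assumes "0 \<le> laplacian f x"
    and le: "\<And>i. f (x + axis i 1) \<le> f x" "\<And>i. f (x - axis i 1) \<le> f x"
  shows "f (x + axis i 1) = f x \<and> f (x - axis i 1) = f x"
proof -
  let ?t = "\<lambda>i. 2 * f x - f (x + axis i 1) - f (x - axis i 1)"
  have nonneg: "0 \<le> ?t j" for j using le[of j] by linarith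
  have "(\<Sum>j\<in>UNIV. ?t j) = - laplacian f x"
    by (simp add: laplacian_eq flip: sum_negf) (simp add: algebra_simps)
  then have "(\<Sum>j\<in>UNIV. ?t j) = 0"
    using assms(1) sum_nonneg[of UNIV ?t] nonneg by simp
  then have "?t i = 0" using nonneg by (simp add: sum_nonneg_eq_0_iff)
  then show ?thesis using le[of i] by linarith
qed

text \<open>The set where the maximum is attained is closed under lattice steps within the box.
  Points on the boundary have neighbours outside, hence the bound on radius
  \<open>r + 1\<close>.\<close>

lemma max_principle_box:
  fixes f :: "int ^ 'n \<Rightarrow> int"
  assumes sub: "\<And>x. x \<in> lattice_box c r \<Longrightarrow> 0 \<le> laplacian f x"
    and le: "\<And>x. x \<in> lattice_box c (r + 1) \<Longrightarrow> f x \<le> m"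
    and x0: "x0 \<in> lattice_box c r" "f x0 = m"
    and y: "y \<in> lattice_box c r"
  shows "f y = m"
  using y x0
proof (rule lattice_box_induct)
  fix x i
  assume x: "x \<in> lattice_box c r" "f x = m"
  show "f (x + axis i 1) = m \<and> f (x - axis i 1) = m"
    using max_principle_neighbours[OF sub[OF x(1)]] le lattice_box_step[OF x(1)] x(2) by simp
qed

text \<open>Since the function is integer-valued, the interval of its values can shrink only finitely
  often while passing to smaller concentric boxes; as soon as it does not shrink, the extremum is
  attained inside the box and the maximum principle applies.\<close>

lemma harmonic_const_on_box:
  fixes u :: "int ^ 'n \<Rightarrow> int"
  assumes "0 \<le> r"
    and "\<And>x. x \<in> lattice_box c (r + int k) \<Longrightarrow> laplacian u x = 0"
    and "\<And>x. x \<in> lattice_box c (r + int k) \<Longrightarrow> b \<le> u x \<and> u x \<le> b + int k"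
    and "x \<in> lattice_box c r"
  shows "u x = u c"
  using assms
proof (induction k)
  case 0
  then have "u x = b" "u c = b"
    using lattice_box_center[of r c] by force+
  then show ?case by simp
next
  case (Suc k)
  have sub: "lattice_box c (r + int k) \<subseteq> lattice_box c (r + int (Suc k))"
    "lattice_box c r \<subseteq> lattice_box c (r + int k)"
    by (rule lattice_box_mono, simp)+
  show ?case
  proof (cases "\<exists>x0\<in>lattice_box c (r + int k). u x0 = b + int (Suc k)")
    case True
    then obtain x0 where x0: "x0 \<in> lattice_box c (r + int k)" "u x0 = b + int (Suc k)" by blast
    have "u y = b + int (Suc k)" if "y \<in> lattice_box c (r + int k)" for y
    proof (rule max_principle_box[where c = c and r = "r + int k" and ?x0.0 = x0])
      show "0 \<le> laplacian u z" if "z \<in> lattice_box c (r + int k)" for z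
        using Suc.prems(2)[of z] sub(1) that by auto
      show "u z \<le> b + int (Suc k)" if "z \<in> lattice_box c (r + int k + 1)" for z
        using Suc.prems(3)[of z] that by (simp add: algebra_simps)
    qed (use x0 that in auto)
    then show ?thesis
      using sub(2) Suc.prems(1,4) lattice_box_center[of r c] by (metis subsetD)
  next
    case False
    show ?thesis
    proof (rule Suc.IH[OF Suc.prems(1) _ _ Suc.prems(4)])
      fix z assume z: "z \<in> lattice_box c (r + int k)"
      then have z': "z \<in> lattice_box c (r + int (Suc k))" using sub(1) by blast
      show "laplacian u z = 0" using Suc.prems(2)[OF z'] .
      have "u z \<noteq> b + int (Suc k)" using False z by blast
      then show "b \<le> u z \<and> u z \<le> b + int k"
        using Suc.prems(3)[OF z'] by simp
    qed
  qed
qed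

text \<open>Each difference of \<open>H\<close> along an axis is harmonic with values in an interval
  of length \<open>2 * K\<close>, which costs \<open>2 * K\<close> layers of the box. One more layer
  is lost to the shifted argument, and one because the differences are needed on radius
  \<open>r + 1\<close>.\<close>

lemma harmonic_affine_on_box:
  fixes H :: "int ^ 'n \<Rightarrow> int"
  assumes "0 \<le> r" and "0 \<le> K"
    and harm: "\<And>x. x \<in> lattice_box c (r + 2 * K + 2) \<Longrightarrow> laplacian H x = 0"
    and lip: "\<And>x i. \<bar>H (x + axis i 1) - H x\<bar> \<le> K"
  obtains p where "\<And>i. \<bar>p $ i\<bar> \<le> K"
    and "\<And>x. x \<in> lattice_box c r \<Longrightarrow> H x = H c + int_inner p (x - c)"
proof -
  define p where "p = (\<chi> i. H (c + axis i 1) - H c)"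
  have D: "H (x + axis i 1) - H x = p $ i" if x: "x \<in> lattice_box c (r + 1)" for x i
  proof -
    let ?u = "\<lambda>x. H (x + axis i 1) - H x"
    have "?u x = ?u c"
    proof (rule harmonic_const_on_box[where u = ?u and r = "r + 1" and k = "nat (2 * K)" and b = "- K"])
      show "laplacian ?u y = 0" if "y \<in> lattice_box c (r + 1 + int (nat (2 * K)))" for y
      proof -
        have y: "y \<in> lattice_box c (r + 2 * K + 1)"
          using that \<open>0 \<le> K\<close> by (simp add: algebra_simps)
        have "y + axis i 1 \<in> lattice_box c (r + 2 * K + 2)"
          using lattice_box_step(1)[OF y] by (simp add: algebra_simps)
        moreover have "y \<in> lattice_box c (r + 2 * K + 2)"
          using y lattice_box_mono[of "r + 2 * K + 1" "r + 2 * K + 2" c] by auto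
        ultimately show ?thesis
          using harm by (simp add: laplacian_diff laplacian_shift)
      qed
      show "- K \<le> ?u y \<and> ?u y \<le> - K + int (nat (2 * K))" for y
        using lip[of y i] \<open>0 \<le> K\<close> by (simp add: abs_le_iff)
    qed (use x \<open>0 \<le> r\<close> in auto)
    then show ?thesis by (simp add: p_def)
  qed
  show thesis
  proof
    show "\<bar>p $ i\<bar> \<le> K" for i using lip by (simp add: p_def)
    fix x assume x: "x \<in> lattice_box c r"
    show "H x = H c + int_inner p (x - c)"
    proof (rule lattice_box_induct[OF x lattice_box_center[OF \<open>0 \<le> r\<close>]])
      fix y i
      assume y: "y \<in> lattice_box c r" and eq: "H y = H c + int_inner p (y - c)"
      have "y \<in> lattice_box c (r + 1)"
        using y lattice_box_mono[of r "r + 1" c] by auto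
      from D[OF this, of i] D[OF lattice_box_step(2)[OF y, of i], of i] eq
      show "H (y + axis i 1) = H c + int_inner p (y + axis i 1 - c) \<and>
            H (y - axis i 1) = H c + int_inner p (y - axis i 1 - c)"
        by (simp add: int_inner_simps)
    qed (simp add: int_inner_zero)
  qed
qed

text \<open>If every translate of \<open>S\<close> met the support of the Laplacian of \<open>H\<close>, the average of \<open>H\<close>
  over translates of \<open>S\<close> plus a small multiple of the squared distance would be strictly
  superharmonic, although it has a minimum because the average grows only linearly.\<close>

lemma harmonic_translate_nearby:
  fixes H :: "int ^ 'n \<Rightarrow> int"
  assumes "finite S" and "0 \<le> K"
  defines "a \<equiv> 4 * int CARD('n) * int (card S) * K"
  assumes L: "L = a + int CARD('n) * a\<^sup>2 + 1"
    and sup: "superharmonic H"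
    and lip: "\<And>x w. \<bar>H (x + w) - H x\<bar> \<le> K * (\<Sum>i\<in>UNIV. \<bar>w $ i\<bar>)"
  shows "\<exists>x\<in>lattice_box z L. \<forall>y\<in>S. laplacian H (x + y) = 0"
proof -
  define n where "n = int CARD('n)"
  have n: "n \<ge> 1" by (simp add: n_def Suc_leI)
  have a: "a \<ge> 0" using \<open>0 \<le> K\<close> by (simp add: a_def)
  have L0: "L \<ge> 0" using a by (simp add: L)
  define T where "T x = (\<Sum>y\<in>S. H (x + y))" for x
  define Q where "Q x = (\<Sum>j\<in>UNIV. (x $ j - z $ j)\<^sup>2)" for x
  \<comment> \<open>The weight beats the Laplacian \<open>2 * n\<close> of \<open>Q\<close>: by
    integrality a nonzero sum of the Laplacians of \<open>H\<close> is at most -1, which would make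
    the Laplacian of \<open>F\<close> negative.\<close>
  define F where "F x = 4 * n * T x + Q x" for x
  have T_ge: "T z - T x \<le> int (card S) * (K * (\<Sum>i\<in>UNIV. \<bar>x $ i - z $ i\<bar>))" for x
  proof -
    have "T z - T x = (\<Sum>y\<in>S. H (z + y) - H (x + y))"
      by (simp add: T_def sum_subtractf)
    also have "\<dots> \<le> (\<Sum>y\<in>S. K * (\<Sum>i\<in>UNIV. \<bar>x $ i - z $ i\<bar>))"
    proof (rule sum_mono)
      fix y
      show "H (z + y) - H (x + y) \<le> K * (\<Sum>i\<in>UNIV. \<bar>x $ i - z $ i\<bar>)"
        using lip[of "z + y" "x - z"] by (simp add: algebra_simps abs_le_iff)
    qed
    finally show ?thesis by simp
  qed
  \<comment> \<open>Here \<open>a\<close> is the Lipschitz constant of \<open>4 * n * T\<close>. A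
    coordinate beyond \<open>L\<close> gains more than \<open>n * a\<^sup>2\<close>, while every
    other one loses at most \<open>a\<^sup>2\<close>. So the minimum over the box is global.\<close>
  have far: "F z < F x" if out: "x \<notin> lattice_box z L" for x
  proof -
    define d where "d j = \<bar>x $ j - z $ j\<bar>" for j
    obtain i where i: "d i > L" using out by (auto simp: lattice_box_def d_def not_le)
    have d2: "d j * d j - a * d j \<ge> - a\<^sup>2" for j
    proof -
      have "0 \<le> (d j - a)\<^sup>2 + a * d j" using a by (simp add: d_def)
      then show ?thesis by (simp add: power2_eq_square algebra_simps)
    qed
    have "n * a\<^sup>2 \<ge> 0" using n by simp
    then have "d i * (d i - a) \<ge> 1 * (n * a\<^sup>2 + 1)"
      using i a unfolding L n_def[symmetric] by (intro mult_mono) auto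
    then have di: "d i * d i - a * d i > n * a\<^sup>2" by (simp add: algebra_simps)
    have "F x - F z = (\<Sum>j\<in>UNIV. d j * d j) - 4 * n * (T z - T x)"
      by (simp add: F_def Q_def d_def algebra_simps power2_eq_square abs_mult_self_eq)
    also have "\<dots> \<ge> (\<Sum>j\<in>UNIV. d j * d j) - 4 * n * (int (card S) * (K * (\<Sum>j\<in>UNIV. d j)))"
      using T_ge[of x] n by (simp add: d_def)
    also have "(\<Sum>j\<in>UNIV. d j * d j) - 4 * n * (int (card S) * (K * (\<Sum>j\<in>UNIV. d j)))
        = (\<Sum>j\<in>UNIV. d j * d j - a * d j)"
      by (simp add: a_def n_def sum_subtractf sum_distrib_left mult.assoc)
    also have "\<dots> = (d i * d i - a * d i) + (\<Sum>j\<in>UNIV - {i}. d j * d j - a * d j)"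
      by (rule sum.remove) auto
    finally have "F x - F z \<ge> (d i * d i - a * d i) + (\<Sum>j\<in>UNIV - {i}. d j * d j - a * d j)" .
    moreover have "(\<Sum>j\<in>UNIV - {i}. d j * d j - a * d j) \<ge> (\<Sum>j\<in>UNIV - {i}. - a\<^sup>2)"
      using d2 by (intro sum_mono)
    moreover have "(\<Sum>j\<in>UNIV - {i}. - a\<^sup>2) \<ge> - (n * a\<^sup>2)"
      by (simp add: n_def card_Diff_singleton mult_right_mono)
    ultimately show ?thesis using di by linarith
  qed
  obtain x where x: "x \<in> lattice_box z L" and min_box: "\<And>y. y \<in> lattice_box z L \<Longrightarrow> F x \<le> F y"
  proof -
    have "finite (F ` lattice_box z L)" "F ` lattice_box z L \<noteq> {}"
      using lattice_box_center[OF L0] finite_lattice_box by auto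
    then show ?thesis using that Min_in[of "F ` lattice_box z L"] Min_le[of "F ` lattice_box z L"]
      by (metis imageE imageI)
  qed
  have min: "F x \<le> F y" for y
    using min_box[of y] min_box[OF lattice_box_center[OF L0]] far[of y] by fastforce
  have "0 \<le> laplacian F x"
    unfolding laplacian_eq using min by (intro sum_nonneg) (smt (verit))
  moreover have "laplacian F x = 4 * n * (\<Sum>y\<in>S. laplacian H (x + y)) + 2 * n"
  proof -
    have "laplacian T x = (\<Sum>y\<in>S. laplacian H (x + y))"
      unfolding T_def by (simp add: laplacian_sum laplacian_shift)
    moreover have "laplacian Q x = 2 * n"
      unfolding Q_def n_def by (rule laplacian_sq_dist)
    moreover have "laplacian F x = laplacian (\<lambda>x. 4 * n * T x) x + laplacian Q x"
      unfolding F_def by (rule laplacian_add)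
    moreover have "laplacian (\<lambda>x. 4 * n * T x) x = 4 * n * laplacian T x"
      by (rule laplacian_cmult)
    ultimately show ?thesis by simp
  qed
  ultimately have "0 \<le> 2 * n * (2 * (\<Sum>y\<in>S. laplacian H (x + y)) + 1)"
    by (simp add: algebra_simps)
  then have "(\<Sum>y\<in>S. laplacian H (x + y)) \<ge> 0"
    using n by (simp add: zero_le_mult_iff)
  moreover have nonpos: "laplacian H (x + y) \<le> 0" for y
    using sup by (simp add: superharmonic_def)
  ultimately have "(\<Sum>y\<in>S. - laplacian H (x + y)) = 0"
    using sum_nonneg[of S "\<lambda>y. - laplacian H (x + y)"] by (simp add: sum_negf)
  then have "\<forall>y\<in>S. laplacian H (x + y) = 0"
    using nonpos \<open>finite S\<close> by (subst (asm) sum_nonneg_eq_0_iff) auto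
  then show ?thesis using x by blast
qed

section \<open>Convexity and inf-convolution\<close>

lemma inj_real_vec: "inj real_vec"
  by (auto simp: inj_def real_vec_def vec_eq_iff)

text \<open>A real separating vector is strictly positive on the finitely many differences
  \<open>q - p\<close>. A large multiple of it survives rounding to integers.\<close>

lemma integer_separation:
  fixes p :: "int ^ 'n"
  assumes "finite B" and "real_vec p \<notin> convex hull (real_vec ` B)"
  shows "\<exists>w. \<forall>q\<in>B. int_inner p w < int_inner q w"
proof -
  have "closed (convex hull (real_vec ` B))"
    using assms(1) by (simp add: compact_imp_closed finite_imp_compact_convex_hull)
  then obtain v b where v: "inner v (real_vec p) < b" "\<And>x. x \<in> convex hull (real_vec ` B) \<Longrightarrow> inner v x > b"
    using separating_hyperplane_closed_point[OF convex_convex_hull _ assms(2)] by blast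
  have pos: "inner v (real_vec (q - p)) > 0" if "q \<in> B" for q
  proof -
    have "inner v (real_vec q) > b" using v(2) that by (simp add: hull_inc)
    moreover have "real_vec (q - p) = real_vec q - real_vec p"
      by (simp add: real_vec_def vec_eq_iff)
    ultimately show ?thesis using v(1) by (simp add: inner_diff_right)
  qed
  \<comment> \<open>The l1 norm of \<open>q - p\<close> bounds the error caused by rounding each
    coordinate.\<close>
  define M where "M q = (\<Sum>i\<in>UNIV. real_of_int \<bar>(q - p) $ i\<bar>)" for q
  have "\<forall>\<^sub>F N in sequentially. \<forall>q\<in>B. M q < real N * inner v (real_vec (q - p))"
  proof (rule eventually_ball_finite[OF assms(1)], rule ballI)
    fix q assume "q \<in> B"
    obtain N0 where N0: "M q < real N0 * inner v (real_vec (q - p))"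
      using reals_Archimedean3[OF pos[OF \<open>q \<in> B\<close>]] by blast
    have "M q < real N * inner v (real_vec (q - p))" if "N \<ge> N0" for N
      using that pos[OF \<open>q \<in> B\<close>] by (intro less_le_trans[OF N0] mult_right_mono) auto
    then show "\<forall>\<^sub>F N in sequentially. M q < real N * inner v (real_vec (q - p))"
      by (auto simp: eventually_sequentially)
  qed
  then obtain N where N: "\<And>q. q \<in> B \<Longrightarrow> M q < real N * inner v (real_vec (q - p))"
    by (auto simp: eventually_sequentially)
  define w :: "int ^ 'n" where "w = (\<chi> i. \<lfloor>real N * v $ i\<rfloor>)"
  have "int_inner p w < int_inner q w" if q: "q \<in> B" for q
  proof -
    have "real N * inner v (real_vec (q - p)) - M q
        = (\<Sum>i\<in>UNIV. real N * v $ i * of_int ((q - p) $ i) - of_int \<bar>(q - p) $ i\<bar>)"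
      by (simp add: M_def inner_vec_def real_vec_def sum_subtractf sum_distrib_left mult.assoc)
    also have "\<dots> \<le> (\<Sum>i\<in>UNIV. of_int (w $ i) * of_int ((q - p) $ i))"
    proof (rule sum_mono)
      fix i
      let ?x = "real N * v $ i" and ?k = "real_of_int ((q - p) $ i)"
      have "\<bar>(?x - of_int (w $ i)) * ?k\<bar> \<le> 1 * \<bar>?k\<bar>"
        unfolding abs_mult w_def by (intro mult_right_mono) (auto, linarith)
      then show "?x * ?k - of_int \<bar>(q - p) $ i\<bar> \<le> of_int (w $ i) * ?k"
        by (simp add: left_diff_distrib abs_le_iff)
    qed
    also have "\<dots> = real_of_int (int_inner q w - int_inner p w)"
      by (simp add: int_inner_def left_diff_distrib sum_subtractf algebra_simps)
    finally show ?thesis using N[OF q] by linarith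
  qed
  then show ?thesis by blast
qed

text \<open>A set of integers bounded below attains its infimum; the bound may vary with
  \<open>z\<close>.\<close>

lemma inf_convolution_exists:
  fixes G h :: "'a::group_add \<Rightarrow> int"
  assumes "\<And>z y. b z \<le> G y + h (z - y)"
  obtains H where "\<And>z y. H z \<le> G y + h (z - y)" and "\<And>z. \<exists>y. H z = G y + h (z - y)"
proof -
  have "\<exists>y. \<forall>y'. G y + h (z - y) \<le> G y' + h (z - y')" for z
  proof -
    obtain y where "\<forall>y'. nat (G y + h (z - y) - b z) \<le> nat (G y' + h (z - y') - b z)"
      using ex_has_least_nat[of "\<lambda>_. True" _ "\<lambda>y. nat (G y + h (z - y) - b z)"] by blast
    then show ?thesis using assms[of z] by (intro exI[of _ y]) (smt (verit) nat_le_eq_zle)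
  qed
  then obtain Y where "\<And>z y'. G (Y z) + h (z - Y z) \<le> G y' + h (z - y')" by metis
  then show thesis using that[of "\<lambda>z. G (Y z) + h (z - Y z)"] by blast
qed

text \<open>Shifting \<open>z\<close> and its minimiser \<open>y\<close> together keeps
  \<open>z - y\<close> fixed, so the second differences of \<open>H\<close> at \<open>z\<close> are
  at most those of \<open>G\<close> at \<open>y\<close>.\<close>

lemma superharmonic_inf_convolution:
  fixes G h H :: "int ^ 'n \<Rightarrow> int"
  assumes "superharmonic G" and le: "\<And>z y. H z \<le> G y + h (z - y)"
    and att: "\<And>z. \<exists>y. H z = G y + h (z - y)"
  shows "superharmonic H"
  unfolding superharmonic_def
proof
  fix z
  obtain y where y: "H z = G y + h (z - y)" using att by blast
  have "laplacian H z \<le> laplacian G y"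
    unfolding laplacian_eq
  proof (rule sum_mono)
    fix i
    show "H (z + axis i 1) + H (z - axis i 1) - 2 * H z \<le> G (y + axis i 1) + G (y - axis i 1) - 2 * G y"
      using le[of "z + axis i 1" "y + axis i 1"] le[of "z - axis i 1" "y - axis i 1"] y by simp
  qed
  also have "\<dots> \<le> 0" using assms(1) by (simp add: superharmonic_def)
  finally show "laplacian H z \<le> 0" .
qed

section \<open>Minima of affine functions\<close>

locale affine_minimum =
  fixes A :: "(int ^ 'n) set" and c :: "int ^ 'n \<Rightarrow> int" and \<Psi> :: "int ^ 'n \<Rightarrow> int"
  assumes finite_A: "finite A" and nonempty_A: "A \<noteq> {}"
    and \<Psi>: "\<And>z. \<Psi> z = Min ((\<lambda>p. int_inner p z + c p) ` A)"
begin

text \<open>The support function of the convex hull of \<open>A\<close>, restricted to lattice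
  vectors.\<close>

definition support :: "int ^ 'n \<Rightarrow> int" where
  "support w = Max ((\<lambda>p. int_inner p w) ` A)"

lemma \<Psi>_le: "p \<in> A \<Longrightarrow> \<Psi> z \<le> int_inner p z + c p"
  using finite_A by (simp add: \<Psi>)

lemma \<Psi>_attained: "\<exists>p\<in>A. \<Psi> z = int_inner p z + c p"
  using Min_in[of "(\<lambda>p. int_inner p z + c p) ` A"] finite_A nonempty_A
  by (fastforce simp: \<Psi>)

lemma support_ge: "p \<in> A \<Longrightarrow> int_inner p w \<le> support w"
  using finite_A by (simp add: support_def)

lemma support_attained: "\<exists>p\<in>A. support w = int_inner p w"
  using Max_in[of "(\<lambda>p. int_inner p w) ` A"] finite_A nonempty_A
  by (fastforce simp: support_def)

lemma support_zero: "support 0 = 0"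
  using support_attained[of 0] by (auto simp: int_inner_zero)

lemma support_add: "support (v + w) \<le> support v + support w"
proof -
  obtain p where "p \<in> A" "support (v + w) = int_inner p v + int_inner p w"
    using support_attained[of "v + w"] by (auto simp: int_inner_add)
  then show ?thesis using support_ge[of p v] support_ge[of p w] by simp
qed

lemma support_le:
  assumes "\<And>p i. p \<in> A \<Longrightarrow> \<bar>p $ i\<bar> \<le> K"
  shows "support w \<le> K * (\<Sum>i\<in>UNIV. \<bar>w $ i\<bar>)"
proof -
  obtain p where p: "p \<in> A" "support w = int_inner p w"
    using support_attained by blast
  show ?thesis using abs_int_inner_le[of p K w] assms[OF p(1)] p(2) by simp
qed

lemma \<Psi>_shift: "\<Psi> z \<le> \<Psi> y + support (z - y)"
proof -
  obtain p where "p \<in> A" "\<Psi> y = int_inner p y + c p" using \<Psi>_attained by blast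
  then show ?thesis using \<Psi>_le[of p z] support_ge[of p "z - y"] by (simp add: int_inner_diff)
qed

text \<open>Otherwise \<open>p\<close> is the only minimal slope at \<open>y\<close>, by a margin
  exceeding \<open>2 * e\<close>. Moving by \<open>m + 1\<close> changes each linear form by at most
  \<open>e\<close>, so \<Psi> is affine at \<open>s\<close> and its neighbours, and its Laplacian
  vanishes there.\<close>

lemma almost_active_near_deviation:
  assumes K: "\<And>p i. p \<in> A \<Longrightarrow> \<bar>p $ i\<bar> \<le> K" and "p \<in> A"
    and s: "s \<in> deviation_set \<Psi>" "y \<in> lattice_box s m"
  shows "\<exists>q\<in>A - {p}. int_inner q y + c q \<le> \<Psi> y + 2 * K * (int CARD('n) * (m + 1))"
proof (rule ccontr)
  define e where "e = K * (int CARD('n) * (m + 1))"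
  assume "\<not> ?thesis"
  then have far: "\<Psi> y + 2 * e < int_inner q y + c q" if "q \<in> A" "q \<noteq> p" for q
    using that by (auto simp: not_le e_def mult.assoc)
  have "K \<ge> 0" using K[OF \<open>p \<in> A\<close>] abs_ge_zero order_trans by blast
  have "m \<ge> 0" using s(2) by (auto simp: lattice_box_def intro: order_trans[OF abs_ge_zero])
  have "e \<ge> 0" using \<open>K \<ge> 0\<close> \<open>m \<ge> 0\<close> by (simp add: e_def)
  have py: "\<Psi> y = int_inner p y + c p"
    using \<Psi>_attained[of y] far \<open>e \<ge> 0\<close> by fastforce
  have close: "\<bar>int_inner q x - int_inner q y\<bar> \<le> e" if "q \<in> A" "x \<in> lattice_box y (m + 1)" for q x
  proof -
    have "\<bar>int_inner q (x - y)\<bar> \<le> K * (\<Sum>i\<in>UNIV. \<bar>(x - y) $ i\<bar>)"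
      using K[OF \<open>q \<in> A\<close>] by (rule abs_int_inner_le)
    also have "\<dots> \<le> e"
      unfolding e_def using lattice_box_sum_le[OF that(2)] \<open>K \<ge> 0\<close> by (rule mult_left_mono)
    finally show ?thesis by (simp add: int_inner_diff)
  qed
  have eq: "\<Psi> x = int_inner p x + c p" if x: "x \<in> lattice_box y (m + 1)" for x
  proof -
    obtain q where q: "q \<in> A" "\<Psi> x = int_inner q x + c q" using \<Psi>_attained by blast
    have "q = p"
    proof (rule ccontr)
      assume "q \<noteq> p"
      then show False
        using far[OF q(1)] close[OF q(1) x] close[OF \<open>p \<in> A\<close> x] \<Psi>_le[OF \<open>p \<in> A\<close>, of x] py q(2)
        by linarith
    qed
    then show ?thesis using q by simp
  qed
  have s': "s \<in> lattice_box y m" using s(2) lattice_box_commute by blast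
  moreover from this have "s \<in> lattice_box y (m + 1)"
    using lattice_box_mono[of m "m + 1" y] by auto
  ultimately have "laplacian \<Psi> s = laplacian (\<lambda>x. int_inner p x + c p) s"
    unfolding laplacian_eq using lattice_box_step[OF s'] by (simp add: eq)
  then show False using s(1) by (simp add: deviation_set_def laplacian_affine)
qed

text \<open>Far along a direction \<open>w\<close> in which only \<open>p\<close> is minimal, the inf-convolution of \<open>G\<close> with the
  support function is not below the \<open>p\<close>-th affine function: wherever \<open>G\<close> differs from \<open>\<Psi>\<close>, some
  other slope is almost active, and the infimum there is controlled by that slope.\<close>

lemma inf_convolution_ge_far:
  assumes G: "G \<in> husking_set k \<Psi>"
    and att: "\<And>z. \<exists>y. H z = G y + support (z - y)"
    and p: "p \<in> A" and w: "\<And>q. q \<in> A - {p} \<Longrightarrow> int_inner p w < int_inner q w"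
  shows "\<exists>t::nat. int_inner p (z + int t *s w) + c p \<le> H (z + int t *s w)"
proof -
  obtain C where C: "C > 0" "{z. \<Psi> z \<noteq> G z} \<subseteq> lattice_nbhd C (deviation_set \<Psi>)"
    and Gk: "\<And>z. \<Psi> z - int k \<le> G z"
    using G by (auto simp: husking_set_def)
  obtain K where "K \<ge> 0" and K: "\<And>q i. q \<in> A \<Longrightarrow> \<bar>q $ i\<bar> \<le> K"
    using finite_subset_lattice_box[OF finite_A] by (auto simp: lattice_box_def)
  \<comment> \<open>The term \<open>k\<close> pays for \<open>G\<close> lying below \<Psi>, the rest
    for the other slope being only almost active.\<close>
  define E where "E = int k + 2 * K * (int CARD('n) * (\<lceil>C\<rceil> + 1))"
  have "E \<ge> 0" using \<open>K \<ge> 0\<close> \<open>C > 0\<close> by (simp add: E_def)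
  \<comment> \<open>The sum dominates each of its terms, and by integrality each step along
    \<open>w\<close> gains at least 1 against every other slope.\<close>
  define t where "t = nat (\<Sum>q\<in>A. \<bar>int_inner p z + c p - (int_inner q z + c q) + E\<bar>)"
  let ?x = "z + int t *s w"
  have large: "int_inner p ?x + c p \<le> int_inner q ?x + c q - E" if q: "q \<in> A - {p}" for q
  proof -
    have "\<bar>int_inner p z + c p - (int_inner q z + c q) + E\<bar> \<le> int t"
      unfolding t_def using q finite_A
      by (simp add: sum_nonneg member_le_sum[of q A "\<lambda>q. \<bar>int_inner p z + c p - (int_inner q z + c q) + E\<bar>"])
    moreover have "int t * (int_inner q w - int_inner p w) \<ge> int t * 1"
      using w[OF q] by (intro mult_left_mono) auto
    ultimately show ?thesis by (simp add: int_inner_simps algebra_simps)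
  qed
  obtain y where y: "H ?x = G y + support (?x - y)" using att by blast
  have "int_inner p ?x + c p \<le> H ?x"
  proof (cases "\<Psi> y = G y")
    case True
    obtain q where "q \<in> A" "\<Psi> ?x = int_inner q ?x + c q" using \<Psi>_attained by blast
    then have "int_inner p ?x + c p \<le> \<Psi> ?x"
      using large[of q] \<open>E \<ge> 0\<close> by (cases "q = p") auto
    then show ?thesis using \<Psi>_shift[of ?x y] y True by simp
  next
    case False
    then obtain s where s: "s \<in> deviation_set \<Psi>" "y \<in> lattice_box s \<lceil>C\<rceil>"
      using C(2) dist_imp_lattice_box unfolding lattice_nbhd_def by blast
    obtain q where q: "q \<in> A - {p}" "int_inner q y + c q \<le> \<Psi> y + (E - int k)"
      using almost_active_near_deviation[OF K p s] by (auto simp: E_def)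
    then show ?thesis
      using large[OF q(1)] Gk[of y] support_ge[of q "?x - y"] y by (simp add: int_inner_diff)
  qed
  then show ?thesis ..
qed

text \<open>Along \<open>w\<close> the function \<open>p \<cdot> x - H x\<close> does not increase, so its constant value on a box is an
  upper bound on all translates of the box, and the maximum principle carries the value along.\<close>

lemma affine_propagates:
  assumes sup: "superharmonic H" and lip: "\<And>x v. H (x + v) \<le> H x + support v"
    and p: "p \<in> A" and w: "\<And>q. q \<in> A - {p} \<Longrightarrow> int_inner p w < int_inner q w"
    and w_box: "w \<in> lattice_box 0 r"
    and eq: "\<And>x. x \<in> lattice_box z (r + 1) \<Longrightarrow> H x = int_inner p x + a"
  shows "H (z + int t *s w) = int_inner p (z + int t *s w) + a"
proof -
  define f where "f x = int_inner p x + a - H x" for x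
  have r: "r \<ge> 0" using w_box by (auto simp: lattice_box_def intro: order_trans[OF abs_ge_zero])
  \<comment> \<open>As \<open>p\<close> minimises the pairing with \<open>w\<close>, it attains the
    support function at \<open>- w\<close>; this yields the monotonicity of
    \<open>f\<close>.\<close>
  have "support (- w) \<le> - int_inner p w"
  proof -
    obtain q where "q \<in> A" "support (- w) = - int_inner q w"
      using support_attained[of "- w"] by (auto simp: int_inner_minus)
    then show ?thesis using w[of q] by (cases "q = p") auto
  qed
  then have mono: "f (x + w) \<le> f x" for x
    using lip[of "x + w" "- w"] by (simp add: f_def int_inner_add)
  have le: "f (x + int t *s w) \<le> 0" if "x \<in> lattice_box z (r + 1)" for x t
  proof (induction t)
    case 0
    then show ?case using eq[OF that] by (simp add: f_def)
  next
    case (Suc t)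
    have "x + int (Suc t) *s w = (x + int t *s w) + w"
      by (simp add: vec_eq_iff algebra_simps)
    then show ?case using mono[of "x + int t *s w"] Suc by (metis order_trans)
  qed
  have "0 \<le> laplacian f x" for x
  proof -
    have "laplacian f x = laplacian (\<lambda>x. int_inner p x + a) x - laplacian H x"
      unfolding f_def by (rule laplacian_diff)
    then show ?thesis using sup by (simp add: laplacian_affine superharmonic_def)
  qed
  have "f (z + int t *s w) = 0"
  proof (induction t)
    case 0
    then show ?case using eq[of z] lattice_box_center[of "r + 1" z] r by (simp add: f_def)
  next
    case (Suc t)
    let ?z = "z + int t *s w"
    show ?case
    \<comment> \<open>The radius \<open>r\<close> is large enough that the next centre lies in the
      box around the current one.\<close>
    proof (rule max_principle_box[where c = ?z and r = r and ?x0.0 = ?z])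
      show "f x \<le> 0" if "x \<in> lattice_box ?z (r + 1)" for x
        using le[of "x - int t *s w" t] that by (simp add: lattice_box_def algebra_simps)
      show "z + int (Suc t) *s w \<in> lattice_box ?z r"
        using w_box by (simp add: lattice_box_def algebra_simps)
    qed (use Suc.IH r \<open>\<And>x. 0 \<le> laplacian f x\<close> lattice_box_center in auto)
  qed
  then show ?thesis by (simp add: f_def)
qed

text \<open>All constants are fixed before \<open>k\<close> and \<open>G\<close> appear, which makes
  the bound uniform.\<close>

lemma uniform_gap:
  assumes sep: "\<And>p. \<exists>w. \<forall>q\<in>A - {p}. int_inner p w < int_inner q w"
  shows "\<exists>N. \<forall>k G z. G \<in> husking_set k \<Psi> \<longrightarrow> \<Psi> z \<le> G z + int N"
proof -
  obtain K where "K \<ge> 0" and K: "\<And>q i. q \<in> A \<Longrightarrow> \<bar>q $ i\<bar> \<le> K"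
    using finite_subset_lattice_box[OF finite_A] by (auto simp: lattice_box_def)
  \<comment> \<open>Directions are chosen also for \<open>p\<close> outside \<open>A\<close>, where
    they will exclude \<open>p\<close> as a slope of \<open>H\<close>.\<close>
  obtain W where W: "\<And>p q. q \<in> A - {p} \<Longrightarrow> int_inner p (W p) < int_inner q (W p)"
    using sep by metis
  \<comment> \<open>The slope of \<open>H\<close> is so far only known to be bounded by
    \<open>K\<close>; one radius serves all these finitely many candidates.\<close>
  obtain r where r0: "r \<ge> 0" and r: "\<And>p. p \<in> lattice_box 0 K \<Longrightarrow> W p \<in> lattice_box 0 r"
    using finite_subset_lattice_box[of "W ` lattice_box 0 K"] finite_lattice_box by blast
  \<comment> \<open>Radius \<open>r + 1\<close> for the affine box, plus the margin of
    \<open>harmonic_affine_on_box\<close>.\<close>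
  define R where "R = r + 1 + 2 * K + 2"
  define a where "a = 4 * int CARD('n) * int (card (lattice_box (0 :: int ^ 'n) R)) * K"
  define L where "L = a + int CARD('n) * a\<^sup>2 + 1"
  \<comment> \<open>Twice the cost of travelling between \<open>z\<close> and \<open>x\<close>: once
    for \<Psi>, once for \<open>H\<close>.\<close>
  define N where "N = 2 * (K * (int CARD('n) * L))"
  have gap: "\<Psi> z \<le> G z + N" if G: "G \<in> husking_set k \<Psi>" for k G z
  proof -
    have supG: "superharmonic G" and G_bounds: "\<And>y. \<Psi> y - int k \<le> G y" "\<And>y. G y \<le> \<Psi> y"
      using G by (auto simp: husking_set_def)
    have "\<Psi> z - int k \<le> G y + support (z - y)" for y z
      using \<Psi>_shift[of z y] G_bounds(1)[of y] by simp
    then obtain H where H_le: "\<And>z y. H z \<le> G y + support (z - y)"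
      and H_att: "\<And>z. \<exists>y. H z = G y + support (z - y)"
      using inf_convolution_exists[of "\<lambda>z. \<Psi> z - int k" G support] by blast
    have supH: "superharmonic H" using supG H_le H_att by (rule superharmonic_inf_convolution)
    have HG: "H y \<le> G y" for y using H_le[of y y] by (simp add: support_zero)
    have H_shift: "H (x + v) \<le> H x + support v" for x v
    proof -
      obtain y where "H x = G y + support (x - y)" using H_att by blast
      then show ?thesis
        using H_le[of "x + v" y] support_add[of "x - y" v] by (simp add: algebra_simps)
    qed
    have lip: "\<bar>H (x + v) - H x\<bar> \<le> K * (\<Sum>i\<in>UNIV. \<bar>v $ i\<bar>)" for x v
      using H_shift[of x v] H_shift[of "x + v" "- v"] support_le[OF K, of v] support_le[OF K, of "- v"]
      by (simp add: abs_le_iff)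
    obtain x where x: "x \<in> lattice_box z L" and harm: "\<And>y. y \<in> lattice_box 0 R \<Longrightarrow> laplacian H (x + y) = 0"
      using harmonic_translate_nearby[OF finite_lattice_box \<open>K \<ge> 0\<close> _ supH lip, of L 0 R z]
      by (auto simp: L_def a_def)
    have "laplacian H y = 0" if "y \<in> lattice_box x (r + 1 + 2 * K + 2)" for y
      using harm[of "y - x"] that by (simp add: lattice_box_def R_def)
    moreover have "\<bar>H (y + axis i 1) - H y\<bar> \<le> K" for y i
      using lip[of y "axis i 1"] by (simp add: axis_def if_distrib cong: if_cong)
    ultimately obtain p where pK: "\<And>i. \<bar>p $ i\<bar> \<le> K"
      and aff: "\<And>y. y \<in> lattice_box x (r + 1) \<Longrightarrow> H y = H x + int_inner p (y - x)"
      using harmonic_affine_on_box[of "r + 1" K x H] r0 \<open>K \<ge> 0\<close> by (metis add_nonneg_nonneg zero_le_one)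
    have W_box: "W p \<in> lattice_box 0 r" using r pK by (simp add: lattice_box_def)
    \<comment> \<open>Otherwise all slopes in \<open>A\<close> pair more with \<open>W p\<close>
      than \<open>p\<close> does, so \<open>H\<close> would grow along \<open>- W p\<close> faster
      than \<open>support\<close> allows.\<close>
    have "p \<in> A"
    proof (rule ccontr)
      assume "p \<notin> A"
      have "W p \<in> lattice_box 0 (r + 1)"
        using W_box lattice_box_mono[of r "r + 1" 0] by auto
      then have "x + - W p \<in> lattice_box x (r + 1)"
        by (simp add: lattice_box_def)
      from aff[OF this] have "int_inner p (- W p) \<le> support (- W p)"
        using H_shift[of x "- W p"] by simp
      moreover obtain q where "q \<in> A" "support (- W p) = int_inner q (- W p)"
        using support_attained by blast
      ultimately show False
        using W[of q p] \<open>p \<notin> A\<close> by (auto simp: int_inner_minus)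
    qed
    define b where "b = H x - int_inner p x"
    have "H (x + int t *s W p) = int_inner p (x + int t *s W p) + b" for t
      using supH H_shift \<open>p \<in> A\<close> W W_box
      by (rule affine_propagates) (use aff in \<open>auto simp: b_def int_inner_diff\<close>)
    moreover obtain t :: nat where "int_inner p (x + int t *s W p) + c p \<le> H (x + int t *s W p)"
      using inf_convolution_ge_far[OF G H_att \<open>p \<in> A\<close> W] by blast
    ultimately have "c p \<le> b" by simp
    then have "\<Psi> x \<le> H x" using \<Psi>_le[OF \<open>p \<in> A\<close>, of x] by (simp add: b_def)
    moreover have "support (z - x) \<le> K * (int CARD('n) * L)" "support (x - z) \<le> K * (int CARD('n) * L)"
      using support_le[OF K, of "z - x"] support_le[OF K, of "x - z"] \<open>K \<ge> 0\<close>
        mult_left_mono[OF lattice_box_sum_le[OF x] \<open>K \<ge> 0\<close>]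
      by (simp_all add: abs_minus_commute)
    moreover have "H x \<le> H z + support (x - z)" using H_shift[of z "x - z"] by simp
    ultimately show ?thesis using \<Psi>_shift[of z x] HG[of z] by (simp add: N_def)
  qed
  show ?thesis
    by (rule exI[of _ "nat N"]) (use gap in \<open>fastforce\<close>)
qed

end

section \<open>Stabilisation of the huskings\<close>

lemma husking_set_mono: "k \<le> l \<Longrightarrow> husking_set k F \<subseteq> husking_set l F"
  unfolding husking_set_def by (intro Collect_mono) (smt (verit) of_nat_mono)

theorem theorem5:
  fixes A :: "(int ^ 'n) set" and c :: "int ^ 'n \<Rightarrow> int" and \<Psi> :: "int ^ 'n \<Rightarrow> int"
  assumes "finite A" and "A \<noteq> {}"
    and "{v. v extreme_point_of (convex hull (real_vec ` A))} = real_vec ` A"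
    and "(convex hull (real_vec ` A)) \<inter> range real_vec = real_vec ` A"
    and "\<And>z. \<Psi> z = Min ((\<lambda>p. int_inner p z + c p) ` A)"
  shows "\<exists>N. \<forall>k>N. husking k \<Psi> = husking N \<Psi>"
proof -
  interpret affine_minimum A c \<Psi>
    using assms(1,2,5) by unfold_locales
  have "\<exists>w. \<forall>q\<in>A - {p}. int_inner p w < int_inner q w" for p
  proof (rule integer_separation)
    show "real_vec p \<notin> convex hull (real_vec ` (A - {p}))"
    proof (cases "p \<in> A")
      case True
      then have "real_vec p extreme_point_of (convex hull (real_vec ` A))" using assms(3) by blast
      \<comment> \<open>Deleting an extreme point leaves a convex set, which contains the hull of
        the other points.\<close>
      then have "convex (convex hull (real_vec ` A) - {real_vec p})"
        by (simp add: extreme_point_of_stillconvex)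
      moreover have "real_vec ` (A - {p}) \<subseteq> convex hull (real_vec ` A) - {real_vec p}"
        using hull_subset[of "real_vec ` A" convex] by (auto dest: injD[OF inj_real_vec])
      ultimately show ?thesis by (metis Diff_iff hull_minimal insertI1 subsetD)
    next
      case False
      then have "real_vec p \<notin> real_vec ` A" by (auto dest: injD[OF inj_real_vec])
      then show ?thesis using False assms(4) by auto
    qed
  qed (use assms(1) in simp)
  then obtain N where N: "\<And>k G z. G \<in> husking_set k \<Psi> \<Longrightarrow> \<Psi> z \<le> G z + int N"
    using uniform_gap by blast
  \<comment> \<open>The lower bound with \<open>N\<close> holds automatically, so enlarging
    \<open>k\<close> admits no new functions.\<close>
  have "husking_set k \<Psi> = husking_set N \<Psi>" if "k > N" for k
  proof
    show "husking_set k \<Psi> \<subseteq> husking_set N \<Psi>"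
    proof
      fix G assume "G \<in> husking_set k \<Psi>"
      with N[OF this] show "G \<in> husking_set N \<Psi>" by (simp add: husking_set_def algebra_simps)
    qed
  qed (use that in \<open>simp add: husking_set_mono\<close>)
  then have "husking k \<Psi> = husking N \<Psi>" if "k > N" for k
    using that by (simp add: husking_def fun_eq_iff)
  then show ?thesis by blast
qed

end
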